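(* Let $X$ be a strongly zero-dimensional Tychonoff space. If $X$ is weakly open-compact attainable, then $X$ is a sequentially Ascoli space.
   Context: All topological spaces are assumed to be Tychonoff. A Tychonoff space $X$ is strongly zero-dimensional if any two completely separated subsets of $X$ can be separated by a clopen set (equivalently, the Stone--Čech compactification $\beta X$ has a base of clopen sets). $X$ is weakly open-compact attainable if for every non-closed open subset $W$ of $X$ there are a point $z\in\overline{W}\setminus W$ and a compact subset $K$ of $X$ such that $z\in K\cap\overline{K\cap W}$. $C_k(X)$ denotes the space of all continuous real-valued functions on $X$ with the compact-open topology; $X$ is sequentially Ascoli if every convergent sequence in $C_k(X)$ is equicontinuous. *)

theory Defs
  imports "HOL-Analysis.Analysis"
begin

definition tychonoff_space :: "'a topology \<Rightarrow> bool" where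
  "tychonoff_space X \<longleftrightarrow> completely_regular_space X \<and> Hausdorff_space X"

definition completely_separated_in :: "'a topology \<Rightarrow> 'a set \<Rightarrow> 'a set \<Rightarrow> bool" where
  "completely_separated_in X A B \<longleftrightarrow>
     A \<subseteq> topspace X \<and> B \<subseteq> topspace X \<and>
     (\<exists>f::'a \<Rightarrow> real. continuous_map X (top_of_set {0..1}) f \<and> f ` A \<subseteq> {0} \<and> f ` B \<subseteq> {1})"

definition strongly_zero_dimensional_space :: "'a topology \<Rightarrow> bool" where
  "strongly_zero_dimensional_space X \<longleftrightarrow>
     (\<forall>A B. completely_separated_in X A B \<longrightarrow>
        (\<exists>U. openin X U \<and> closedin X U \<and> A \<subseteq> U \<and> U \<inter> B = {}))"

definition weakly_open_compact_attainable :: "'a topology \<Rightarrow> bool" where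
  "weakly_open_compact_attainable X \<longleftrightarrow>
     (\<forall>W. openin X W \<and> \<not> closedin X W \<longrightarrow>
        (\<exists>z K. z \<in> X closure_of W - W \<and> compactin X K \<and> z \<in> K \<inter> X closure_of (K \<inter> W)))"

text \<open>
  The underlying set of \<open>C\<^sub>k(X)\<close>: functions are normalised to be \<^const>\<open>undefined\<close> off
  \<open>topspace X\<close>, so that elements correspond exactly to continuous functions on \<open>X\<close>.
\<close>
definition real_continuous_maps :: "'a topology \<Rightarrow> ('a \<Rightarrow> real) set" where
  "real_continuous_maps X =
     {f \<in> extensional (topspace X). continuous_map X euclideanreal f}"

text \<open>The compact-open topology, generated by the subbase of sets of \<open>f\<close> with \<open>f(K) \<subseteq> U\<close>.\<close>
definition Ck :: "'a topology \<Rightarrow> ('a \<Rightarrow> real) topology" where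
  "Ck X = topology_generated_by
     {{f \<in> real_continuous_maps X. f ` K \<subseteq> U} | K U. compactin X K \<and> open U}"

lemma topspace_Ck [simp]: "topspace (Ck X) = real_continuous_maps X"
proof
  show "topspace (Ck X) \<subseteq> real_continuous_maps X"
    unfolding Ck_def by auto
  have "compactin X {} \<and> open (UNIV :: real set)" by simp
  then show "real_continuous_maps X \<subseteq> topspace (Ck X)"
    unfolding Ck_def topology_generated_by_topspace by blast
qed

definition equicontinuous_in :: "'a topology \<Rightarrow> ('a \<Rightarrow> real) set \<Rightarrow> bool" where
  "equicontinuous_in X F \<longleftrightarrow>
     (\<forall>x \<in> topspace X. \<forall>\<epsilon>>0. \<exists>U. openin X U \<and> x \<in> U \<and> (\<forall>f\<in>F. \<forall>y\<in>U. \<bar>f y - f x\<bar> < \<epsilon>))"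

text \<open>
  The explicit range condition is needed because \<^const>\<open>limitin\<close> only constrains the
  sequence eventually.
\<close>
definition sequentially_Ascoli_space :: "'a topology \<Rightarrow> bool" where
  "sequentially_Ascoli_space X \<longleftrightarrow>
     (\<forall>(\<sigma> :: nat \<Rightarrow> 'a \<Rightarrow> real) g.
        range \<sigma> \<subseteq> topspace (Ck X) \<and> limitin (Ck X) \<sigma> g sequentially \<longrightarrow>
        equicontinuous_in X (range \<sigma>))"

end

theory Submission
  imports Defs
begin

text \<open>
  Let \<open>\<sigma> n\<close> converge to \<open>g\<close> in \<open>C\<^sub>k(X)\<close> and suppose equicontinuity fails at \<open>x\<close>.  Strong
  zero-dimensionality gives clopen sets \<open>C n\<close> with
  \<open>{\<bar>\<sigma> n - g\<bar> \<ge> 2\<delta>} \<subseteq> C n \<subseteq> {\<bar>\<sigma> n - g\<bar> > \<delta>}\<close>.  For a late tail the union \<open>W\<close> of the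
  \<open>C n\<close> misses \<open>x\<close> but has \<open>x\<close> in its closure.  Uniform convergence on a compact set \<open>K\<close>
  means that \<open>K\<close> meets only finitely many \<open>C n\<close>, so the closure of \<open>K \<inter> W\<close> stays inside
  \<open>W\<close>, contradicting weak open-compact attainability.
\<close>

text \<open>A finite cover of \<open>K\<close> by compact pieces \<open>L y\<close>, on each of
  which \<open>g\<close> stays within \<delta>/3 of \<open>g y\<close>, reduces uniform closeness to
  finitely many subbasic neighbourhoods of \<open>g\<close>.\<close>

lemma Ck_limitin_imp_uniform_on_compact:
  assumes lim: "limitin (Ck X) \<sigma> g F" and K: "compactin X K" and "\<delta> > 0"
  shows "eventually (\<lambda>n. \<forall>y\<in>K. \<bar>\<sigma> n y - g y\<bar> < \<delta>) F"
proof -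
  have gR: "g \<in> real_continuous_maps X"
    using lim by (simp add: limitin_def)
  then have g: "continuous_map X euclideanreal g"
    by (simp add: real_continuous_maps_def)
  \<comment> \<open>The closed ball makes \<open>L y\<close> relatively closed in \<open>K\<close>,
    hence compact and usable in the subbase of \<open>Ck X\<close>.\<close>
  define L where "L y = K \<inter> {x \<in> topspace X. g x \<in> cball (g y) (\<delta>/3)}" for y
  have L: "compactin X (L y)" for y
    unfolding L_def
    by (rule compact_Int_closedin [OF K closedin_continuous_map_preimage [OF g]]) simp
  have KX: "K \<subseteq> topspace X"
    using K compactin_subset_topspace by blast
  have "compact (g ` K)"
    using image_compactin [OF K g] by simp
  moreover have "g ` K \<subseteq> (\<Union>s\<in>g ` K. ball s (\<delta>/3))"
    using \<open>\<delta> > 0\<close> by force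
  ultimately obtain S where S: "S \<subseteq> g ` K" "finite S" "g ` K \<subseteq> (\<Union>s\<in>S. ball s (\<delta>/3))"
    by (rule compactE_image [OF _ open_ball])
  obtain T where T: "T \<subseteq> K" "finite T" "S = g ` T"
    using S finite_subset_image by metis
  \<comment> \<open>The open ball of radius 2\<delta>/3 contains the closed \<delta>/3-ball, so
    \<open>g\<close> itself lies in \<open>?N\<close>; the remaining \<delta>/3 pays for replacing
    \<open>g y\<close> by \<open>g x\<close>.\<close>
  have "eventually (\<lambda>n. \<sigma> n ` L y \<subseteq> ball (g y) (2*\<delta>/3)) F" for y
  proof -
    let ?N = "{f \<in> real_continuous_maps X. f ` L y \<subseteq> ball (g y) (2*\<delta>/3)}"
    have "openin (Ck X) ?N"
      unfolding Ck_def using L by (intro topology_generated_by_Basis) blast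
    moreover have "g \<in> ?N"
      using gR \<open>\<delta> > 0\<close> by (auto simp: L_def)
    ultimately have "eventually (\<lambda>n. \<sigma> n \<in> ?N) F"
      using lim unfolding limitin_def by blast
    then show ?thesis
      by (rule eventually_mono) blast
  qed
  then have "eventually (\<lambda>n. \<forall>y\<in>T. \<sigma> n ` L y \<subseteq> ball (g y) (2*\<delta>/3)) F"
    using \<open>finite T\<close> by (simp add: eventually_ball_finite)
  then show ?thesis
  proof (rule eventually_mono, intro ballI)
    fix n x
    assume n: "\<forall>y\<in>T. \<sigma> n ` L y \<subseteq> ball (g y) (2*\<delta>/3)" and x: "x \<in> K"
    obtain y where y: "y \<in> T" "dist (g y) (g x) < \<delta>/3"
      using S(3) T(3) x by auto
    then have "x \<in> L y"
      using x KX by (auto simp: L_def)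
    then have "dist (g y) (\<sigma> n x) < 2*\<delta>/3"
      using n y(1) by (meson image_subset_iff mem_ball)
    with y(2) show "\<bar>\<sigma> n x - g x\<bar> < \<delta>"
      unfolding dist_real_def by linarith
  qed
qed

lemma completely_separated_in_sublevel_superlevel:
  assumes h: "continuous_map X euclideanreal h" and "a < b"
  shows "completely_separated_in X {x \<in> topspace X. h x \<le> a} {x \<in> topspace X. b \<le> h x}"
proof -
  \<comment> \<open>Affine rescaling sending \<open>a\<close> to 0 and \<open>b\<close> to 1,
    truncated to the unit interval.\<close>
  define k where "k x = max 0 (min 1 ((h x - a) / (b - a)))" for x
  have "continuous_map X euclideanreal (\<lambda>x. (h x - a) / (b - a))"
    using \<open>a < b\<close> by (intro continuous_map_real_divide continuous_map_diff h) auto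
  then have "continuous_map X euclideanreal k"
    unfolding k_def
    by (intro continuous_map_real_max continuous_map_real_min) auto
  then have "continuous_map X (top_of_set {0..1}) k"
    by (auto simp: continuous_map_in_subtopology k_def)
  moreover have "k ` {x \<in> topspace X. h x \<le> a} \<subseteq> {0}"
    using \<open>a < b\<close> by (auto simp: k_def divide_simps)
  moreover have "k ` {x \<in> topspace X. b \<le> h x} \<subseteq> {1}"
    using \<open>a < b\<close> by (auto simp: k_def divide_simps)
  ultimately show ?thesis
    unfolding completely_separated_in_def by blast
qed

text \<open>The gap between \<open>a\<close> and \<open>b\<close> completely separates the two level
  sets; \<open>C\<close> is the complement of a clopen set around the sublevel set.\<close>

lemma strongly_zero_dimensional_clopen_between:
  assumes X: "strongly_zero_dimensional_space X"
    and h: "continuous_map X euclideanreal h" and "a < b"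
  obtains C where "openin X C" "closedin X C"
    "{x \<in> topspace X. b \<le> h x} \<subseteq> C" "C \<subseteq> {x \<in> topspace X. a < h x}"
proof -
  obtain U where U: "openin X U" "closedin X U" "{x \<in> topspace X. h x \<le> a} \<subseteq> U"
      "U \<inter> {x \<in> topspace X. b \<le> h x} = {}"
    using X completely_separated_in_sublevel_superlevel [OF h \<open>a < b\<close>]
    unfolding strongly_zero_dimensional_space_def by meson
  show thesis
  proof
    show "openin X (topspace X - U)" "closedin X (topspace X - U)"
      using U by auto
  qed (use U in auto)
qed

lemma finite_imp_equicontinuous_in:
  assumes "finite F" and F: "\<And>f. f \<in> F \<Longrightarrow> continuous_map X euclideanreal f"
  shows "equicontinuous_in X F"
  unfolding equicontinuous_in_def
proof (intro ballI allI impI)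
  fix x and \<epsilon> :: real
  assume x: "x \<in> topspace X" and "\<epsilon> > 0"
  \<comment> \<open>Intersecting with \<open>topspace X\<close> keeps \<open>U\<close> open for
    empty \<open>F\<close>, where the inner intersection is \<open>UNIV\<close>.\<close>
  define U where "U = topspace X \<inter> (\<Inter>f\<in>F. {y \<in> topspace X. f y \<in> ball (f x) \<epsilon>})"
  have "openin X {y \<in> topspace X. f y \<in> ball (f x) \<epsilon>}" if "f \<in> F" for f
    by (rule openin_continuous_map_preimage [OF F [OF that]]) simp
  then have "openin X U"
    unfolding U_def using \<open>finite F\<close> by (cases "F = {}") auto
  moreover have "x \<in> U"
    using x \<open>\<epsilon> > 0\<close> by (simp add: U_def)
  moreover have "\<forall>f\<in>F. \<forall>y\<in>U. \<bar>f y - f x\<bar> < \<epsilon>"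
    by (auto simp: U_def dist_real_def abs_minus_commute)
  ultimately show "\<exists>U. openin X U \<and> x \<in> U \<and> (\<forall>f\<in>F. \<forall>y\<in>U. \<bar>f y - f x\<bar> < \<epsilon>)"
    by blast
qed

text \<open>Inside a compact \<open>K\<close> the union agrees with a finite, hence closed,
  subunion, so closure points of \<open>K \<inter> ?W\<close> stay in \<open>?W\<close> and no
  attaining point \<open>z\<close> can exist.\<close>

lemma closedin_Union_clopen_of_compact_finite:
  assumes X: "weakly_open_compact_attainable X"
    and C: "\<And>i. i \<in> I \<Longrightarrow> openin X (C i)" "\<And>i. i \<in> I \<Longrightarrow> closedin X (C i)"
    and fin: "\<And>K. compactin X K \<Longrightarrow> finite {i \<in> I. K \<inter> C i \<noteq> {}}"
  shows "closedin X (\<Union>i\<in>I. C i)"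
proof (rule ccontr)
  let ?W = "\<Union>i\<in>I. C i"
  assume "\<not> closedin X ?W"
  moreover have "openin X ?W"
    using C by blast
  ultimately obtain z K where z: "z \<in> X closure_of ?W - ?W" "compactin X K"
      "z \<in> K \<inter> X closure_of (K \<inter> ?W)"
    using X unfolding weakly_open_compact_attainable_def by meson
  let ?J = "{i \<in> I. K \<inter> C i \<noteq> {}}"
  have "closedin X (\<Union>i\<in>?J. C i)"
    using fin [OF z(2)] C by (intro closedin_Union) auto
  then have "X closure_of (K \<inter> ?W) \<subseteq> (\<Union>i\<in>?J. C i)"
    by (rule closure_of_minimal [rotated]) auto
  then show False
    using z by blast
qed

theorem proposition2p13:
  fixes X :: "'a topology"
  assumes "tychonoff_space X"
    and "strongly_zero_dimensional_space X"
    and "weakly_open_compact_attainable X"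
  shows "sequentially_Ascoli_space X"
  unfolding sequentially_Ascoli_space_def
proof (intro allI impI, elim conjE)
  fix \<sigma> :: "nat \<Rightarrow> 'a \<Rightarrow> real" and g
  assume ran: "range \<sigma> \<subseteq> topspace (Ck X)" and lim: "limitin (Ck X) \<sigma> g sequentially"
  have \<sigma>: "continuous_map X euclideanreal (\<sigma> n)" for n
    using ran by (auto simp: real_continuous_maps_def)
  have g: "continuous_map X euclideanreal g"
    using lim by (simp add: limitin_def real_continuous_maps_def)
  show "equicontinuous_in X (range \<sigma>)"
    unfolding equicontinuous_in_def
  proof (intro ballI allI impI)
    fix x and \<epsilon> :: real
    assume x: "x \<in> topspace X" and "\<epsilon> > 0"
    \<comment> \<open>Error budget at a nearby \<open>y\<close>: 2\<delta> for
      \<open>\<sigma> n y\<close> against \<open>g y\<close>, and \<delta> each for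
      \<open>g y\<close> against \<open>g x\<close> and \<open>g x\<close> against
      \<open>\<sigma> n x\<close>.\<close>
    define \<delta> where "\<delta> = \<epsilon>/4"
    have "\<delta> > 0" using \<open>\<epsilon> > 0\<close> by (simp add: \<delta>_def)
    have abs: "continuous_map X euclideanreal (\<lambda>y. \<bar>\<sigma> n y - g y\<bar>)" for n
      by (intro continuous_map_real_abs continuous_map_diff \<sigma> g)
    have "\<forall>n. \<exists>C. openin X C \<and> closedin X C \<and>
        {y \<in> topspace X. 2*\<delta> \<le> \<bar>\<sigma> n y - g y\<bar>} \<subseteq> C \<and> C \<subseteq> {y \<in> topspace X. \<delta> < \<bar>\<sigma> n y - g y\<bar>}"
      by (rule allI, rule strongly_zero_dimensional_clopen_between [OF assms(2) abs, of \<delta> "2*\<delta>"])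
        (use \<open>\<delta> > 0\<close> in auto)
    from choice [OF this] obtain C where "\<forall>n. openin X (C n) \<and> closedin X (C n) \<and>
        {y \<in> topspace X. 2*\<delta> \<le> \<bar>\<sigma> n y - g y\<bar>} \<subseteq> C n \<and>
        C n \<subseteq> {y \<in> topspace X. \<delta> < \<bar>\<sigma> n y - g y\<bar>}" ..
    then have C: "\<And>n. openin X (C n)" "\<And>n. closedin X (C n)"
        "\<And>n. {y \<in> topspace X. 2*\<delta> \<le> \<bar>\<sigma> n y - g y\<bar>} \<subseteq> C n"
        "\<And>n. C n \<subseteq> {y \<in> topspace X. \<delta> < \<bar>\<sigma> n y - g y\<bar>}"
      by blast+
    have compact_uniform: "\<exists>N. \<forall>n\<ge>N. \<forall>y\<in>K. \<bar>\<sigma> n y - g y\<bar> < \<delta>" if "compactin X K" for K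
      using Ck_limitin_imp_uniform_on_compact [OF lim that \<open>\<delta> > 0\<close>]
      by (simp add: eventually_sequentially)
    \<comment> \<open>Convergence on the compact singleton \<open>{x}\<close> keeps \<open>x\<close>
      out of \<open>C n\<close> for all \<open>n \<ge> N\<close>.\<close>
    obtain N where N: "\<And>n. n \<ge> N \<Longrightarrow> \<bar>\<sigma> n x - g x\<bar> < \<delta>"
      using compact_uniform [of "{x}"] x by auto
    define W where "W = (\<Union>n\<in>{N..}. C n)"
    have "closedin X W"
      unfolding W_def
    proof (rule closedin_Union_clopen_of_compact_finite [OF assms(3)])
      fix K assume "compactin X K"
      then obtain M where M: "\<And>n y. n \<ge> M \<Longrightarrow> y \<in> K \<Longrightarrow> \<bar>\<sigma> n y - g y\<bar> < \<delta>"
        using compact_uniform by blast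
      \<comment> \<open>On \<open>C n\<close> the error exceeds \<delta>, whereas on
        \<open>K\<close> it is below \<delta> from \<open>M\<close> on.\<close>
      have "n < M" if "y \<in> K" "y \<in> C n" for n y
        using M [of n y] C(4) [of n] that by force
      then have "{n \<in> {N..}. K \<inter> C n \<noteq> {}} \<subseteq> {..<M}"
        by auto
      then show "finite {n \<in> {N..}. K \<inter> C n \<noteq> {}}"
        using finite_subset by blast
    qed (use C in auto)
    have "x \<notin> W"
      using N C(4) unfolding W_def by force
    \<comment> \<open>The first \<open>N\<close> functions are not controlled by \<open>W\<close>;
      as a finite family they receive their own neighbourhood \<open>U\<close>.\<close>
    have "equicontinuous_in X (\<sigma> ` {..<N})" "equicontinuous_in X {g}"
      using \<sigma> g by (auto intro!: finite_imp_equicontinuous_in)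
    then obtain U V where U: "openin X U" "x \<in> U" "\<forall>f\<in>\<sigma> ` {..<N}. \<forall>y\<in>U. \<bar>f y - f x\<bar> < \<epsilon>"
      and V: "openin X V" "x \<in> V" "\<forall>f\<in>{g}. \<forall>y\<in>V. \<bar>f y - f x\<bar> < \<delta>"
      using x \<open>\<epsilon> > 0\<close> \<open>\<delta> > 0\<close> unfolding equicontinuous_in_def by meson
    \<comment> \<open>Removing the closed set \<open>W\<close> leaves an open neighbourhood of
      \<open>x\<close> on which every late function is within 2\<delta> of \<open>g\<close>.\<close>
    have "\<bar>\<sigma> n y - \<sigma> n x\<bar> < \<epsilon>" if y: "y \<in> (U \<inter> V) - W" for n y
    proof (cases "n < N")
      case False
      have "y \<in> topspace X"
        using y U(1) openin_subset by blast
      then have "\<bar>\<sigma> n y - g y\<bar> < 2*\<delta>"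
        using C(3) [of n] y False unfolding W_def by force
      moreover have "\<bar>\<sigma> n x - g x\<bar> < \<delta>" "\<bar>g y - g x\<bar> < \<delta>"
        using N V(3) y False by auto
      ultimately show ?thesis
        unfolding \<delta>_def by linarith
    qed (use U y in auto)
    then have "\<forall>f\<in>range \<sigma>. \<forall>y\<in>(U \<inter> V) - W. \<bar>f y - f x\<bar> < \<epsilon>"
      by blast
    moreover have "openin X ((U \<inter> V) - W)"
      using U(1) V(1) \<open>closedin X W\<close> by (intro openin_diff openin_Int)
    ultimately show "\<exists>U. openin X U \<and> x \<in> U \<and> (\<forall>f\<in>range \<sigma>. \<forall>y\<in>U. \<bar>f y - f x\<bar> < \<epsilon>)"
      using U(2) V(2) \<open>x \<notin> W\<close> by blast
  qed
qed

end
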